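(* For every even positive integer $n$ and all non-negative integers $i,j$, the polynomial $$P(x)=x^{\frac{2(2^n-1)}{3}+2^i}+x^{\frac{2(2^n-1)}{3}+2^j}+x^{\frac{2^n-1}{3}+2^i}+x^{\frac{2^n-1}{3}+2^j}+x^{2^i}$$ is a permutation polynomial of $\mathbb{F}_{2^n}$.
   Context: A polynomial is a permutation polynomial (PP) of a finite field if it induces a bijection of that field to itself. *)

theory Defs
  imports "HOL-Computational_Algebra.Polynomial" "HOL-Library.Cardinality"
begin

definition permutation_poly :: "'a::{field, finite} poly \<Rightarrow> bool" where
  "permutation_poly p \<longleftrightarrow> bij (poly p)"

text \<open>The divisions by 3 are exact when \<open>n\<close> is even, since then 3 divides \<open>2 ^ n - 1\<close>.\<close>

definition P_poly :: "nat \<Rightarrow> nat \<Rightarrow> nat \<Rightarrow> 'a::field poly" where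
  "P_poly n i j =
     monom 1 ((2 * (2 ^ n - 1)) div 3 + 2 ^ i)
   + monom 1 ((2 * (2 ^ n - 1)) div 3 + 2 ^ j)
   + monom 1 ((2 ^ n - 1) div 3 + 2 ^ i)
   + monom 1 ((2 ^ n - 1) div 3 + 2 ^ j)
   + monom 1 (2 ^ i)"

end

theory Submission imports Defs begin

text \<open>
  Put \<open>w = x\<^bsup>(2^n-1)/3\<^esup>\<close>, a cube root of unity if \<open>x \<noteq> 0\<close>. Since \<open>w\<^sup>2 + w + 1\<close> is 1 or 0
  according to whether \<open>w = 1\<close>, the polynomial acts as \<open>x \<mapsto> x\<^bsup>2^i\<^esup>\<close> on the nonzero cubes and as
  \<open>x \<mapsto> x\<^bsup>2^j\<^esup>\<close> elsewhere. Both maps are injective and preserve the set of nonzero cubes.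
\<close>

text \<open>Translation by 1 permutes the field, so adding 1 to every element leaves the sum of all
  elements unchanged. Hence \<open>2 ^ n\<close> vanishes in the field, and so does 2.\<close>

lemma two_eq_0_if_card_power_2:
  assumes "CARD('a::{field, finite}) = 2 ^ n"
  shows "(2 :: 'a) = 0"
proof -
  have "(\<Sum>x::'a\<in>UNIV. x) = (\<Sum>x::'a\<in>UNIV. x + 1)"
    by (rule sum.reindex_bij_witness[of _ "\<lambda>x. x + 1" "\<lambda>x. x - 1"]) auto
  then have "(of_nat CARD('a) :: 'a) = 0"
    by (simp add: sum.distrib)
  then show ?thesis
    by (simp add: assms)
qed

text \<open>Multiplication by \<open>x\<close> permutes the nonzero elements; their product is
  nonzero and cancels.\<close>

lemma power_card_minus_1_eq_1:
  fixes x :: "'a::{field, finite}"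
  assumes "x \<noteq> 0"
  shows "x ^ (CARD('a) - 1) = 1"
proof -
  let ?U = "UNIV - {0 :: 'a}"
  have "(\<Prod>y\<in>?U. y) = (\<Prod>y\<in>?U. x * y)"
    by (rule prod.reindex_bij_witness[of _ "\<lambda>y. x * y" "\<lambda>y. y / x"]) (use assms in auto)
  then have "(\<Prod>y\<in>?U. y) = x ^ card ?U * (\<Prod>y\<in>?U. y)"
    by (simp add: prod.distrib)
  then show ?thesis
    by (simp add: card_Diff_singleton)
qed

lemma power_2_power_inj:
  fixes x y :: "'a::idom"
  assumes "(2 :: 'a) = 0" "x ^ (2 ^ k) = y ^ (2 ^ k)"
  shows "x = y"
  using assms(2)
proof (induction k arbitrary: x y)
  case (Suc k)
  \<comment> \<open>The induction hypothesis is applied to the squares of \<open>x\<close> and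
    \<open>y\<close>, which leaves a single squaring to undo.\<close>
  then have eq: "x\<^sup>2 = y\<^sup>2"
    by (simp add: power_mult)
  have "(x - y)\<^sup>2 = x\<^sup>2 + y\<^sup>2 - 2 * x * y"
    by (rule power2_diff)
  also have "\<dots> = 2 * (y\<^sup>2 - x * y)"
    by (simp add: eq algebra_simps)
  finally show ?case
    using assms(1) by simp
qed simp

lemma poly_P_poly:
  fixes x :: "'a::{field, finite}"
  assumes "even n" and "CARD('a) = 2 ^ n"
  shows "poly (P_poly n i j) x = (if x ^ ((2 ^ n - 1) div 3) = 1 then x ^ 2 ^ i else x ^ 2 ^ j)"
proof (cases "x = 0")
  case True
  then show ?thesis
    by (simp add: P_poly_def poly_monom power_0_left)
next
  case False
  define m where "m = (2 ^ n - 1 :: nat) div 3"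
  define w where "w = x ^ m"
  have two: "(2 :: 'a) = 0"
    by (rule two_eq_0_if_card_power_2) fact
  obtain k where "n = 2 * k"
    using assms(1) by blast
  then have "(2 ^ n :: nat) mod 3 = 4 ^ k mod 3"
    by (simp add: power_mult)
  also have "\<dots> = (4 mod 3) ^ k mod 3"
    by (rule power_mod[symmetric])
  finally have "(2 ^ n :: nat) mod 3 = 1"
    by simp
  then have m3: "2 ^ n - 1 = 3 * m"
    unfolding m_def by presburger
  have "w ^ 3 = x ^ (CARD('a) - 1)"
    unfolding w_def assms(2) m3 by (simp add: mult.commute flip: power_mult)
  then have "w ^ 3 = 1"
    using power_card_minus_1_eq_1[OF False] by simp
  then have "(w - 1) * (w\<^sup>2 + w + 1) = 0"
    by (simp add: algebra_simps power2_eq_square power3_eq_cube)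
  then consider "w = 1" | "w \<noteq> 1" "w\<^sup>2 + w + 1 = 0"
    by auto
  \<comment> \<open>The coefficient \<open>w\<^sup>2 + w\<close> of \<open>x ^ 2 ^ j\<close> is
    written as \<open>(w\<^sup>2 + w + 1) - 1\<close>, so that one factor decides both cases: it is
    3 = 1 if \<open>w = 1\<close> and 0 otherwise. The sign left over disappears in characteristic
    2.\<close>
  moreover have "poly (P_poly n i j) x = (w\<^sup>2 + w + 1) * x ^ 2 ^ i + (w\<^sup>2 + w + 1) * x ^ 2 ^ j - x ^ 2 ^ j"
  proof -
    have "2 * (2 ^ n - 1) div 3 = m + m"
      unfolding m3 by simp
    then show ?thesis
      unfolding P_poly_def m_def[symmetric]
      by (simp add: poly_monom power_add w_def algebra_simps power2_eq_square)
  qed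
  moreover have "- a = a" for a :: 'a
    using two by (metis add_eq_0_iff2 mult_2 mult_zero_left)
  ultimately show ?thesis
    unfolding m_def[symmetric] w_def[symmetric] using two by cases auto
qed

theorem theorem1p2:
  fixes n i j :: nat
  assumes "n > 0" and "even n"
    and "CARD('a::{field, finite}) = 2 ^ n"
  shows "permutation_poly (P_poly n i j :: 'a poly)"
proof -
  define m where "m = (2 ^ n - 1 :: nat) div 3"
  let ?P = "P_poly n i j :: 'a poly"
  have two: "(2 :: 'a) = 0"
    by (rule two_eq_0_if_card_power_2) fact
  have P: "poly ?P x = (if x ^ m = 1 then x ^ 2 ^ i else x ^ 2 ^ j)" for x
    unfolding m_def by (rule poly_P_poly) fact+
  \<comment> \<open>The left side says that \<open>x ^ m\<close> and 1 have the same
    \<open>2 ^ k\<close>-th power.\<close>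
  have cube: "(x ^ 2 ^ k) ^ m = 1 \<longleftrightarrow> x ^ m = 1" for x :: 'a and k
    using power_2_power_inj[OF two, of "x ^ m" k 1]
    by (metis power_commutes power_mult mult.commute power_one)
  have "inj (poly ?P)"
  proof (rule injI)
    fix x y
    assume eq: "poly ?P x = poly ?P y"
    \<comment> \<open>Since each class is mapped into itself, equal values force \<open>x\<close>
      and \<open>y\<close> into the same class, where a single injective power map acts.\<close>
    have "poly ?P z ^ m = 1 \<longleftrightarrow> z ^ m = 1" for z
      by (simp add: P cube)
    then have "x ^ m = 1 \<longleftrightarrow> y ^ m = 1"
      using eq by metis
    then show "x = y"
      using eq power_2_power_inj[OF two] by (auto simp: P split: if_splits)
  qed
  then show ?thesis
    by (simp add: permutation_poly_def bij_def finite_UNIV_inj_surj)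
qed

end
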